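(* Let $d\ge1$. (i) All unit-interval $d$-dimensional simplicial complexes are skeleton-E-chordal. (ii) All underclosed $d$-dimensional simplicial complexes are skeleton-weakly-chordal. In each dimension $d\geq 1$ both inclusions are strict: there are $d$-dimensional skeleton-E-chordal complexes that are not unit-interval, and $d$-dimensional skeleton-weakly-chordal complexes that are not underclosed.
   Context: Simplicial complexes are finite and not necessarily pure. A vertex labeling of a complex with $n$ vertices is a bijection of its vertices with $[n]=\{1,\dots,n\}$; $\min F,\max F$ denote the smallest and largest labels in $F$; the size of a face is its number of vertices. For sets $G=\{g_0<\dots<g_k\}$, $F=\{f_0<\dots<f_k\}$ of the same size, $G\le F$ componentwise means $g_i\le f_i$ for all $i$. A complex $\Delta$ with $n$ vertices is: - unit-interval, if it has a labeling such that for every facet $F$ of $\Delta$, every subset of $\{\min F,\min F+1,\dots,\max F\}$ of size $|F|$ is a face of $\Delta$; - underclosed, if it has a labeling such that for every facet $F$ of $\Delta$ and every $G\subseteq[n]$ with $|G|=|F|$, if $\min G=\min F$ and $G\le F$ componentwise, then $G\in\Delta$; - skeleton-E-chordal, if it has a labeling such that for every two faces $f\ne g$ of $\Delta$ with the same size and same maximum, every subset $h\subseteq f\cup g$ with $|h|=|f|$ is a face of $\Delta$; - skeleton-weakly-chordal, if it has a labeling such that for every two faces $f\neq g$ of $\Delta$ with the same size and same maximum, $\Delta$ contains some face $h$ with $|h|=|f|$ and $h\subseteq (f\cup g)\setminus\{\max f\}$. *)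

theory Defs
  imports Main
begin

text \<open>
  Finite abstract simplicial complexes, not necessarily pure. The empty set is a face of every
  complex, so the vertices of \<open>\<Delta>\<close> are exactly the elements of \<open>\<Union>\<Delta>\<close>.
\<close>

definition abstract_complex :: "'a set set \<Rightarrow> bool" where
  "abstract_complex \<Delta> \<longleftrightarrow>
     finite (\<Union>\<Delta>) \<and> {} \<in> \<Delta> \<and> (\<forall>F\<in>\<Delta>. \<forall>G. G \<subseteq> F \<longrightarrow> G \<in> \<Delta>)"

definition vertices :: "'a set set \<Rightarrow> 'a set" where
  "vertices \<Delta> = \<Union>\<Delta>"

definition complex_dim :: "'a set set \<Rightarrow> int" where
  "complex_dim \<Delta> = int (Max (card ` \<Delta>)) - 1"

definition facets :: "'a set set \<Rightarrow> 'a set set" where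
  "facets \<Delta> = {F \<in> \<Delta>. \<forall>G\<in>\<Delta>. F \<subseteq> G \<longrightarrow> G = F}"

definition vertex_labeling :: "'a set set \<Rightarrow> ('a \<Rightarrow> nat) \<Rightarrow> bool" where
  "vertex_labeling \<Delta> l \<longleftrightarrow> bij_betw l (vertices \<Delta>) {1..card (vertices \<Delta>)}"

definition relabel :: "('a \<Rightarrow> nat) \<Rightarrow> 'a set set \<Rightarrow> nat set set" where
  "relabel l \<Delta> = (\<lambda>F. l ` F) ` \<Delta>"

text \<open>For finite sets, \<open>componentwise_le G F\<close> also forces \<open>G\<close> and \<open>F\<close> to have the same size.\<close>

definition componentwise_le :: "nat set \<Rightarrow> nat set \<Rightarrow> bool" where
  "componentwise_le G F \<longleftrightarrow> list_all2 (\<le>) (sorted_list_of_set G) (sorted_list_of_set F)"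

text \<open>
  The four properties below are conditions on the isomorphic copy \<open>relabel l \<Delta>\<close> of \<open>\<Delta>\<close>, whose
  faces are subsets of \<open>{1..card (vertices \<Delta>)}\<close>. The only facet for which \<open>Min\<close> and \<open>Max\<close> are
  unspecified is \<open>{}\<close>, where the conditions hold trivially. Two distinct faces of the same size
  are nonempty, so \<open>Max f\<close> is meaningful in the last two definitions.
\<close>

definition unit_interval :: "'a set set \<Rightarrow> bool" where
  "unit_interval \<Delta> \<longleftrightarrow>
     (\<exists>l. vertex_labeling \<Delta> l \<and>
        (\<forall>F\<in>facets (relabel l \<Delta>). \<forall>G. G \<subseteq> {Min F..Max F} \<and> card G = card F
           \<longrightarrow> G \<in> relabel l \<Delta>))"

definition underclosed :: "'a set set \<Rightarrow> bool" where
  "underclosed \<Delta> \<longleftrightarrow>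
     (\<exists>l. vertex_labeling \<Delta> l \<and>
        (\<forall>F\<in>facets (relabel l \<Delta>). \<forall>G. G \<subseteq> {1..card (vertices \<Delta>)} \<and> card G = card F \<and>
           Min G = Min F \<and> componentwise_le G F \<longrightarrow> G \<in> relabel l \<Delta>))"

definition skeleton_E_chordal :: "'a set set \<Rightarrow> bool" where
  "skeleton_E_chordal \<Delta> \<longleftrightarrow>
     (\<exists>l. vertex_labeling \<Delta> l \<and>
        (\<forall>f\<in>relabel l \<Delta>. \<forall>g\<in>relabel l \<Delta>. f \<noteq> g \<and> card f = card g \<and> Max f = Max g \<longrightarrow>
           (\<forall>h. h \<subseteq> f \<union> g \<and> card h = card f \<longrightarrow> h \<in> relabel l \<Delta>)))"

definition skeleton_weakly_chordal :: "'a set set \<Rightarrow> bool" where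
  "skeleton_weakly_chordal \<Delta> \<longleftrightarrow>
     (\<exists>l. vertex_labeling \<Delta> l \<and>
        (\<forall>f\<in>relabel l \<Delta>. \<forall>g\<in>relabel l \<Delta>. f \<noteq> g \<and> card f = card g \<and> Max f = Max g \<longrightarrow>
           (\<exists>h\<in>relabel l \<Delta>. card h = card f \<and> h \<subseteq> (f \<union> g) - {Max f})))"

end

theory Submission imports Defs begin

text \<open>
  Both inclusions rest on extending a face to a facet. For (i), if \<open>Min f \<le> Min g\<close> and \<open>f \<subseteq> F\<close>
  with \<open>F\<close> a facet, then every \<open>h \<subseteq> f \<union> g\<close> of size \<open>|f|\<close> lies in the interval spanned by \<open>F\<close>
  and extends there to a set of size \<open>|F|\<close>. For (ii), in the same situation, exchange \<open>Max f\<close>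
  for some \<open>x \<in> g - f\<close>, both in \<open>f\<close> and in \<open>F\<close>.

  Unit-interval implies underclosed and skeleton-E-chordal implies skeleton-weakly-chordal, so a
  single complex shows that both inclusions are strict: the disjoint union of a \<open>d\<close>-simplex with
  the smallest tree that is not an interval graph (three paths of length two glued at an end).
\<close>

section \<open>Faces, facets and relabeling\<close>

lemma abstract_complexD:
  assumes "abstract_complex \<Delta>"
  shows "finite \<Delta>" and "F \<in> \<Delta> \<Longrightarrow> finite F" and "F \<in> \<Delta> \<Longrightarrow> G \<subseteq> F \<Longrightarrow> G \<in> \<Delta>"
proof -
  have fin: "finite (\<Union>\<Delta>)"
    using assms by (simp add: abstract_complex_def)
  then show "finite \<Delta>"
    by (rule finite_UnionD)
  show "finite F" if "F \<in> \<Delta>"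
    using fin by (rule rev_finite_subset) (use that in blast)
  show "G \<in> \<Delta>" if "F \<in> \<Delta>" "G \<subseteq> F"
    using assms that unfolding abstract_complex_def by blast
qed

lemma face_in_facet:
  assumes "abstract_complex \<Delta>" "f \<in> \<Delta>"
  obtains F where "F \<in> facets \<Delta>" "f \<subseteq> F"
proof -
  obtain F where "F \<in> \<Delta>" "f \<subseteq> F" "\<forall>G\<in>\<Delta>. F \<subseteq> G \<longrightarrow> F = G"
    using finite_has_maximal2[OF abstract_complexD(1)[OF assms(1)] assms(2)] by blast
  then show thesis
    using that[of F] by (auto simp: facets_def)
qed

lemma abstract_complex_relabel:
  assumes "abstract_complex \<Delta>"
  shows "abstract_complex (relabel l \<Delta>)"
  unfolding abstract_complex_def
proof (intro conjI ballI allI impI)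
  have "\<Union>(relabel l \<Delta>) = l ` \<Union>\<Delta>"
    by (auto simp: relabel_def)
  then show "finite (\<Union>(relabel l \<Delta>))"
    using assms by (simp add: abstract_complex_def)
  show "{} \<in> relabel l \<Delta>"
    using assms by (force simp: relabel_def abstract_complex_def)
next
  fix F G assume "F \<in> relabel l \<Delta>" "G \<subseteq> F"
  then show "G \<in> relabel l \<Delta>"
    using abstract_complexD(3)[OF assms] by (auto simp: relabel_def subset_image_iff)
qed

lemma relabel_subset_labels:
  assumes "vertex_labeling \<Delta> l" "F \<in> relabel l \<Delta>"
  shows "F \<subseteq> {1..card (vertices \<Delta>)}"
  using assms unfolding vertex_labeling_def bij_betw_def relabel_def vertices_def by blast

text \<open>Injectivity on the vertices reflects inclusions between faces, so maximality survives
  relabeling.\<close>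

lemma facets_relabel:
  assumes "inj_on l (vertices \<Delta>)" "F \<in> facets \<Delta>"
  shows "l ` F \<in> facets (relabel l \<Delta>)"
proof -
  have "H = F" if "H \<in> \<Delta>" "l ` F \<subseteq> l ` H" for H
  proof -
    have "F \<subseteq> vertices \<Delta>" "H \<subseteq> vertices \<Delta>"
      using assms(2) that(1) by (auto simp: vertices_def facets_def)
    then have "F \<subseteq> H"
      using that(2) assms(1) unfolding inj_on_def by blast
    then show ?thesis
      using assms(2) that(1) by (auto simp: facets_def)
  qed
  then show ?thesis
    using assms(2) by (auto simp: facets_def relabel_def)
qed

section \<open>From unit-interval to skeleton-E-chordal\<close>

lemma unit_interval_imp_skeleton_E_chordal:
  assumes \<Delta>: "abstract_complex \<Delta>" and ui: "unit_interval \<Delta>"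
  shows "skeleton_E_chordal \<Delta>"
proof -
  obtain l where l: "vertex_labeling \<Delta> l"
    and facet: "\<And>F G. F \<in> facets (relabel l \<Delta>) \<Longrightarrow> G \<subseteq> {Min F..Max F} \<Longrightarrow> card G = card F
      \<Longrightarrow> G \<in> relabel l \<Delta>"
    using ui unfolding unit_interval_def by blast
  define K where "K = relabel l \<Delta>"
  have K: "abstract_complex K"
    unfolding K_def by (rule abstract_complex_relabel[OF \<Delta>])
  \<comment> \<open>Passes the facet condition down to any nonempty face, whose interval lies in
    that of each facet above it.\<close>
  have key: "h \<in> K" if f: "f \<in> K" "f \<noteq> {}" and h: "h \<subseteq> {Min f..Max f}" "card h = card f" for f h
  proof -
    obtain F where F: "F \<in> facets K" "f \<subseteq> F"
      using face_in_facet[OF K f(1)] by blast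
    have FK: "F \<in> K" and fin: "finite F"
      using F(1) abstract_complexD(2)[OF K] by (auto simp: facets_def)
    have "h \<subseteq> {Min F..Max F}"
      using h(1) Min_antimono[OF F(2) f(2) fin] Max_mono[OF F(2) f(2) fin] by force
    moreover have "F \<subseteq> {Min F..Max F}"
      using fin by auto
    then have "card F \<le> card {Min F..Max F}"
      by (intro card_mono) auto
    moreover have "card h \<le> card F"
      using h(2) card_mono[OF fin F(2)] by simp
    ultimately obtain G where "h \<subseteq> G" "G \<subseteq> {Min F..Max F}" "card G = card F"
      using exists_subset_between[of h "card F" "{Min F..Max F}"] by auto
    then show ?thesis
      using facet F(1) abstract_complexD(3)[OF K] unfolding K_def by blast
  qed
  have "h \<in> K" if fg: "f \<in> K" "g \<in> K" "f \<noteq> g" "card f = card g" "Max f = Max g"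
    and h: "h \<subseteq> f \<union> g" "card h = card f" for f g h
  proof -
    have fin: "finite f" "finite g"
      using fg abstract_complexD(2)[OF K] by auto
    then have ne: "f \<noteq> {}" "g \<noteq> {}"
      using fg(3,4) by auto
    have "f \<subseteq> {Min f..Max f}" "g \<subseteq> {Min g..Max g}"
      using fin by (simp_all add: subset_iff)
    \<comment> \<open>As the maxima agree, the interval with the smaller minimum contains the other
      one.\<close>
    then have "h \<subseteq> {Min f..Max f} \<or> h \<subseteq> {Min g..Max g}"
      using h(1) fg(5) by (cases "Min f \<le> Min g") fastforce+
    then show ?thesis
      using key fg(1,2,4) ne h(2) by metis
  qed
  then show ?thesis
    using l unfolding skeleton_E_chordal_def K_def by blast
qed

section \<open>From underclosed to skeleton-weakly-chordal\<close>

lemma list_all2_insort_remove1: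
  assumes "sorted xs" "m \<in> set xs" "x \<le> m"
  shows "list_all2 (\<le>) (insort x (remove1 m xs)) (xs :: 'a :: linorder list)"
  using assms
proof (induction xs arbitrary: x)
  case (Cons a xs)
  have le: "a \<le> y" if "y \<in> set xs" for y
    using Cons.prems(1) that by auto
  show ?case
  proof (cases "a = m")
    case True
    then have "insort x xs = x # xs"
      using le Cons.prems(3) by (cases xs) (auto intro: order_trans)
    then show ?thesis
      using True Cons.prems(3) by (simp add: list_all2_refl)
  next
    case False
    then have m: "m \<in> set xs"
      using Cons.prems(2) by simp
    have "insort a (remove1 m xs) = a # remove1 m xs"
      using le notin_set_remove1 by (metis insort_is_Cons)
    \<comment> \<open>Induction hypothesis with \<open>a\<close> inserted: it serves the case
      \<open>x \<le> a\<close>, where \<open>x\<close> takes the head and \<open>a\<close> moves one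
      place right. The hypothesis for \<open>x\<close> itself serves the other case.\<close>
    then have "list_all2 (\<le>) (a # remove1 m xs) xs"
      using Cons.IH[of a] Cons.prems(1) m le by simp
    moreover have "list_all2 (\<le>) (insort x (remove1 m xs)) xs"
      using Cons.IH[of x] Cons.prems m by simp
    ultimately show ?thesis
      using False by simp
  qed
qed simp

text \<open>The entries between \<open>x\<close> and \<open>m\<close> move one place up the sorted
  list and so face larger entries; all others stay in place.\<close>

lemma componentwise_le_exchange:
  assumes "finite F" "m \<in> F" "x \<notin> F" "x \<le> m"
  shows "componentwise_le (insert x (F - {m})) F"
proof -
  have "sorted_list_of_set (insert x (F - {m})) = insort x (remove1 m (sorted_list_of_set F))"
    using assms by (simp add: sorted_list_of_set.sorted_key_list_of_set_remove)
  then show ?thesis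
    using assms list_all2_insort_remove1[of "sorted_list_of_set F" m x]
    by (simp add: componentwise_le_def)
qed

lemma underclosed_imp_skeleton_weakly_chordal:
  assumes \<Delta>: "abstract_complex \<Delta>" and uc: "underclosed \<Delta>"
  shows "skeleton_weakly_chordal \<Delta>"
proof -
  obtain l where l: "vertex_labeling \<Delta> l"
    and facet: "\<And>F G. F \<in> facets (relabel l \<Delta>) \<Longrightarrow> G \<subseteq> {1..card (vertices \<Delta>)} \<Longrightarrow>
      card G = card F \<Longrightarrow> Min G = Min F \<Longrightarrow> componentwise_le G F \<Longrightarrow> G \<in> relabel l \<Delta>"
    using uc unfolding underclosed_def by blast
  define K where "K = relabel l \<Delta>"
  have K: "abstract_complex K"
    unfolding K_def by (rule abstract_complex_relabel[OF \<Delta>])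
  note sub = relabel_subset_labels[OF l, folded K_def]
  \<comment> \<open>Assuming \<open>Min f \<le> Min g\<close> loses no generality: \<open>f\<close>
    and \<open>g\<close> enter symmetrically, as their sizes and maxima agree.\<close>
  have key: "\<exists>h\<in>K. card h = card f \<and> h \<subseteq> (f \<union> g) - {Max f}"
    if fg: "f \<in> K" "g \<in> K" "f \<noteq> g" "card f = card g" "Max f = Max g" "Min f \<le> Min g" for f g
  proof -
    have fin: "finite f" "finite g"
      using fg abstract_complexD(2)[OF K] by auto
    then have ne: "f \<noteq> {}" "g \<noteq> {}"
      using fg(3,4) by auto
    define m where "m = Max f"
    have m: "m \<in> f" "m \<in> g"
      using Max_in[OF fin(1) ne(1)] Max_in[OF fin(2) ne(2)] fg(5) by (auto simp: m_def)
    obtain x where x: "x \<in> g" "x \<notin> f"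
      using card_subset_eq[OF fin(1), of g] fg(3,4) by auto
    have "x \<noteq> m"
      using x m by auto
    moreover have "x \<le> m"
      using x(1) fin fg(5) by (simp add: m_def)
    ultimately have xm: "x < m"
      by simp
    \<comment> \<open>Together with \<open>x < m\<close> this gives
      \<open>Min F \<le> Min f < x < m\<close>, so exchanging \<open>m\<close> for \<open>x\<close>
      in \<open>F\<close> keeps the minimum.\<close>
    have "Min f \<le> x"
      using fg(6) x(1) fin(2) by (meson Min_le order_trans)
    moreover have "Min f \<in> f"
      using fin ne by simp
    ultimately have xf: "Min f < x"
      using x(2) by (metis le_neq_implies_less)
    define h where "h = insert x (f - {m})"
    have "card h = card f"
      using fin m x card_Suc_Diff1[OF fin(1) m(1)] by (simp add: h_def)
    moreover have "h \<subseteq> (f \<union> g) - {Max f}"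
      using x xm by (auto simp: h_def m_def)
    moreover have "h \<in> K"
    proof -
      obtain F where F: "F \<in> facets K" "f \<subseteq> F"
        using face_in_facet[OF K fg(1)] by blast
      have FK: "F \<in> K" and finF: "finite F"
        using F(1) abstract_complexD(2)[OF K] by (auto simp: facets_def)
      show ?thesis
      \<comment> \<open>If \<open>x\<close> is in \<open>F\<close>, the exchange would shrink
        \<open>F\<close>, but \<open>h\<close> already lies in \<open>F\<close>.\<close>
      proof (cases "x \<in> F")
        case True
        then have "h \<subseteq> F"
          using F(2) by (auto simp: h_def)
        then show ?thesis
          using FK abstract_complexD(3)[OF K] by blast
      next
        case False
        define G where "G = insert x (F - {m})"
        have mF: "m \<in> F"
          using m F(2) by auto
        have "card G = card F"
          using finF False mF card_Suc_Diff1[OF finF mF] by (simp add: G_def)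
        moreover have "G \<subseteq> {1..card (vertices \<Delta>)}"
          using sub[OF FK] sub[OF fg(2)] x(1) by (auto simp: G_def)
        moreover have "Min G = Min F"
        proof (rule Min_eqI)
          have "F \<noteq> {}"
            using mF by auto
          have "Min F \<le> Min f"
            using Min_antimono[OF F(2) ne(1) finF] .
          then show "Min F \<in> G"
            using xf xm Min_in[OF finF \<open>F \<noteq> {}\<close>] by (simp add: G_def)
          show "Min F \<le> y" if "y \<in> G" for y
            using that finF \<open>Min F \<le> Min f\<close> xf by (auto simp: G_def)
        qed (simp add: G_def finF)
        moreover have "componentwise_le G F"
          unfolding G_def using componentwise_le_exchange[OF finF mF False] xm by simp
        ultimately have "G \<in> K"
          using facet F(1) unfolding K_def by blast
        moreover have "h \<subseteq> G"
          using F(2) by (auto simp: h_def G_def)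
        ultimately show ?thesis
          using abstract_complexD(3)[OF K] by blast
      qed
    qed
    ultimately show ?thesis
      by blast
  qed
  have "\<exists>h\<in>K. card h = card f \<and> h \<subseteq> (f \<union> g) - {Max f}"
    if "f \<in> K" "g \<in> K" "f \<noteq> g" "card f = card g" "Max f = Max g" for f g
    using key[of f g] key[of g f] that by (metis Un_commute nle_le)
  then show ?thesis
    using l unfolding skeleton_weakly_chordal_def K_def by blast
qed

section \<open>Implications that let one example serve both strictness claims\<close>

lemma skeleton_E_chordal_imp_skeleton_weakly_chordal:
  assumes \<Delta>: "abstract_complex \<Delta>" and "skeleton_E_chordal \<Delta>"
  shows "skeleton_weakly_chordal \<Delta>"
proof -
  obtain l where l: "vertex_labeling \<Delta> l"
    and chordal: "\<forall>f\<in>relabel l \<Delta>. \<forall>g\<in>relabel l \<Delta>. f \<noteq> g \<and> card f = card g \<and> Max f = Max g \<longrightarrow>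
      (\<forall>h. h \<subseteq> f \<union> g \<and> card h = card f \<longrightarrow> h \<in> relabel l \<Delta>)"
    using assms(2) unfolding skeleton_E_chordal_def by blast
  have "\<exists>h\<in>relabel l \<Delta>. card h = card f \<and> h \<subseteq> (f \<union> g) - {Max f}"
    if fg: "f \<in> relabel l \<Delta>" "g \<in> relabel l \<Delta>" "f \<noteq> g" "card f = card g" "Max f = Max g" for f g
  proof -
    have fin: "finite f" "finite g"
      using fg abstract_complexD(2)[OF abstract_complex_relabel[OF \<Delta>]] by auto
    \<comment> \<open>An element of \<open>g\<close> outside \<open>f\<close> leaves room for
      \<open>card f\<close> elements in the union after its maximum is deleted.\<close>
    have "\<not> g \<subseteq> f"
      using card_subset_eq[OF fin(1), of g] fg(3,4) by auto
    then have "card f < card (f \<union> g)"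
      using fin by (intro psubset_card_mono) auto
    then have "card f \<le> card (f \<union> g - {Max f})"
      using diff_card_le_card_Diff[of "{Max f}" "f \<union> g"] by simp
    then obtain h where h: "h \<subseteq> (f \<union> g) - {Max f}" "card h = card f"
      by (meson obtain_subset_with_card_n)
    then have "h \<in> relabel l \<Delta>"
      using chordal fg by (meson Diff_subset order_trans)
    then show ?thesis
      using h by blast
  qed
  then show ?thesis
    using l unfolding skeleton_weakly_chordal_def by blast
qed

lemma componentwise_le_imp_Max_le:
  assumes "componentwise_le G F" "finite G" "finite F" "x \<in> G"
  shows "x \<le> Max F"
proof -
  let ?G = "sorted_list_of_set G" and ?F = "sorted_list_of_set F"
  obtain i where "i < length ?G" "?G ! i = x"
    using assms(2,4) by (metis in_set_conv_nth set_sorted_list_of_set)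
  then have "x \<le> ?F ! i" "?F ! i \<in> set ?F"
    using assms(1) unfolding componentwise_le_def
    by (auto simp: list_all2_conv_all_nth simp del: set_sorted_list_of_set)
  then show ?thesis
    using assms(3) by (auto intro: order_trans)
qed

text \<open>Equal minima bound \<open>G\<close> from below and the componentwise order bounds it by
  \<open>Max F\<close>, so \<open>G\<close> lies in the interval spanned by
  \<open>F\<close>.\<close>

lemma unit_interval_imp_underclosed:
  assumes \<Delta>: "abstract_complex \<Delta>" and "unit_interval \<Delta>"
  shows "underclosed \<Delta>"
proof -
  obtain l where l: "vertex_labeling \<Delta> l"
    and facet: "\<And>F G. F \<in> facets (relabel l \<Delta>) \<Longrightarrow> G \<subseteq> {Min F..Max F} \<Longrightarrow> card G = card F
      \<Longrightarrow> G \<in> relabel l \<Delta>"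
    using assms(2) unfolding unit_interval_def by blast
  have "G \<in> relabel l \<Delta>"
    if F: "F \<in> facets (relabel l \<Delta>)" and G: "G \<subseteq> {1..card (vertices \<Delta>)}" "card G = card F"
      "Min G = Min F" "componentwise_le G F" for F G
  proof -
    have "finite F"
      using F abstract_complexD(2)[OF abstract_complex_relabel[OF \<Delta>]] by (auto simp: facets_def)
    moreover have "finite G"
      using G(1) finite_subset by blast
    ultimately have "G \<subseteq> {Min F..Max F}"
      using componentwise_le_imp_Max_le[OF G(4)] G(3) Min_le[of G] by auto
    then show ?thesis
      using facet F G(2) by blast
  qed
  then show ?thesis
    using l unfolding underclosed_def by blast
qed

section \<open>Edges of underclosed complexes\<close>

lemma componentwise_le_pair:
  assumes "a < b" "b \<le> c"
  shows "componentwise_le {a, b} {a, c}"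
proof -
  have "sorted_list_of_set {a, y} = [a, y]" if "a < y" for y
    using that by simp
  then show ?thesis
    using assms by (simp add: componentwise_le_def)
qed

text \<open>For two-element facets with a fixed minimum, the componentwise order only compares the
  larger labels. Pulled back to the original vertices, the condition uses the labels merely as a
  linear order.\<close>

lemma underclosed_edge:
  fixes \<Delta> :: "'a set set"
  assumes "underclosed \<Delta>"
  obtains l :: "'a \<Rightarrow> nat" where "inj_on l (vertices \<Delta>)"
    and "\<And>x y z. {x, y} \<in> facets \<Delta> \<Longrightarrow> z \<in> vertices \<Delta> \<Longrightarrow> l x < l z \<Longrightarrow> l z \<le> l y \<Longrightarrow> {x, z} \<in> \<Delta>"
proof -
  obtain l where l: "vertex_labeling \<Delta> l"
    and facet: "\<And>F G. F \<in> facets (relabel l \<Delta>) \<Longrightarrow> G \<subseteq> {1..card (vertices \<Delta>)} \<Longrightarrow>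
      card G = card F \<Longrightarrow> Min G = Min F \<Longrightarrow> componentwise_le G F \<Longrightarrow> G \<in> relabel l \<Delta>"
    using assms unfolding underclosed_def by blast
  have inj: "inj_on l (vertices \<Delta>)" and img: "l ` vertices \<Delta> = {1..card (vertices \<Delta>)}"
    using l by (auto simp: vertex_labeling_def bij_betw_def)
  have "{x, z} \<in> \<Delta>"
    if e: "{x, y} \<in> facets \<Delta>" and z: "z \<in> vertices \<Delta>" and le: "l x < l z" "l z \<le> l y" for x y z
  proof -
    have x: "x \<in> vertices \<Delta>"
      using e by (auto simp: facets_def vertices_def)
    have "{l x, l y} \<in> facets (relabel l \<Delta>)"
      using facets_relabel[OF inj e] by simp
    moreover have "{l x, l z} \<subseteq> {1..card (vertices \<Delta>)}"
      using x z img by blast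
    ultimately have "{l x, l z} \<in> relabel l \<Delta>"
      using le componentwise_le_pair[OF le] by (intro facet[of "{l x, l y}"]) auto
    then obtain H where H: "H \<in> \<Delta>" "l ` H = l ` {x, z}"
      by (auto simp: relabel_def)
    have "H \<subseteq> vertices \<Delta>" "{x, z} \<subseteq> vertices \<Delta>"
      using H(1) x z by (auto simp: vertices_def)
    then have "H = {x, z}"
      using H(2) inj_on_image_eq_iff[OF inj] by blast
    then show ?thesis
      using H(1) by simp
  qed
  then show thesis
    using that inj by blast
qed

section \<open>The separating example\<close>

text \<open>
  The tree has root \<open>1\<close> with children \<open>2, 3, 4\<close>, and each such child \<open>i\<close> has the single child
  \<open>i + 3\<close>. Every vertex is larger than its parent, so every tree edge is determined by its maximum.
\<close>

definition parent :: "nat \<Rightarrow> nat" where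
  "parent k = (if k \<le> 4 then 1 else k - 3)"

text \<open>The block \<open>{8..8 + d}\<close> supplies the dimension and is disjoint from the tree
  on \<open>{1..7}\<close>. Consecutive numbering makes the identity a vertex labeling.\<close>

definition spider :: "nat \<Rightarrow> nat set set" where
  "spider d = Pow {8..8 + d} \<union> (\<Union>k\<in>{2..7}. Pow {parent k, k})"

lemma spider_cases:
  assumes "F \<in> spider d"
  obtains "F \<subseteq> {8..8 + d}" | k where "k \<in> {2..7}" "F \<subseteq> {parent k, k}"
  using assms unfolding spider_def by blast

lemma parent_bounds:
  assumes "k \<in> {2..7}"
  shows "1 \<le> parent k" "parent k < k" "parent k \<le> 4"
  using assms by (auto simp: parent_def)

lemma vertices_spider: "vertices (spider d) = {1..8 + d}"
proof
  show "vertices (spider d) \<subseteq> {1..8 + d}"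
    using parent_bounds by (fastforce simp: vertices_def elim!: spider_cases)
  show "{1..8 + d} \<subseteq> vertices (spider d)"
  proof
    fix x assume x: "x \<in> {1..8 + d}"
    consider "x = 1" | "x \<in> {2..7}" | "x \<in> {8..8 + d}"
      using x by force
    then have "{x} \<in> spider d"
    proof cases
      case 1
      then have "{x} \<subseteq> {parent 2, 2}"
        by (simp add: parent_def)
      then show ?thesis
        unfolding spider_def by (intro UnI2 UN_I[of 2]) auto
    qed (auto simp: spider_def)
    then show "x \<in> vertices (spider d)"
      by (auto simp: vertices_def)
  qed
qed

lemma abstract_complex_spider: "abstract_complex (spider d)"
  unfolding abstract_complex_def
proof (intro conjI ballI allI impI)
  show "finite (\<Union>(spider d))"
    using vertices_spider[of d] by (simp add: vertices_def)
  show "{} \<in> spider d"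
    by (simp add: spider_def)
  show "G \<in> spider d" if "F \<in> spider d" "G \<subseteq> F" for F G
    using that unfolding spider_def by blast
qed

lemma complex_dim_spider:
  assumes "d \<ge> 1"
  shows "complex_dim (spider d) = int d"
proof -
  have "Max (card ` spider d) = d + 1"
  proof (rule Max_eqI)
    show "finite (card ` spider d)"
      using abstract_complexD(1)[OF abstract_complex_spider] by simp
    show "y \<le> d + 1" if y: "y \<in> card ` spider d" for y
    proof -
      obtain F where F: "F \<in> spider d" "y = card F"
        using y by auto
      from F(1) show ?thesis
      proof (cases rule: spider_cases)
        case 1
        then show ?thesis
          using F(2) card_mono[of "{8..8 + d}" F] by simp
      next
        case (2 k)
        then have "card F \<le> 2"
          using card_mono[of "{parent k, k}" F] card_insert_le_m1[of 2 "{k}" "parent k"] by simp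
        \<comment> \<open>Tree faces have at most two vertices, which \<open>d \<ge> 1\<close> keeps
          within \<open>d + 1\<close>.\<close>
        then show ?thesis
          using F(2) assms by simp
      qed
    qed
    have "{8..8 + d} \<in> spider d"
      by (simp add: spider_def)
    then show "d + 1 \<in> card ` spider d"
      by (rule rev_image_eqI) simp
  qed
  then show ?thesis
    by (simp add: complex_dim_def)
qed

text \<open>A tree face is determined by its maximum and its size, since a vertex has at most one
  smaller neighbor. Distinct faces agreeing in both therefore lie in the simplex, where every subset
  is a face.\<close>

lemma skeleton_E_chordal_spider: "skeleton_E_chordal (spider d)"
  unfolding skeleton_E_chordal_def
proof (intro exI[of _ id] conjI ballI allI impI)
  show "vertex_labeling (spider d) id"
    by (simp add: vertex_labeling_def vertices_spider)
next
  have rel: "relabel id (spider d) = spider d"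
    by (simp add: relabel_def)
  have Max_in: "Max f \<in> f" if "f \<in> spider d" "f \<noteq> {}" for f
    using abstract_complexD(2)[OF abstract_complex_spider that(1)] that(2) by simp
  have small: "f = {Max f} \<or> f = {parent (Max f), Max f}"
    if f: "f \<in> spider d" "f \<noteq> {}" "Max f < 8" for f
    using f(1)
  proof (cases rule: spider_cases)
    case 1
    then have "Max f \<in> {8..8 + d}"
      using Max_in[OF f(1,2)] by blast
    then show ?thesis
      using f(3) by simp
  next
    case (2 k)
    have "f = {parent k} \<or> f = {k} \<or> f = {parent k, k}"
      using 2(2) f(2) by blast
    then show ?thesis
      using parent_bounds(2)[OF 2(1)] by (auto simp: max_def)
  qed
  have large: "f \<subseteq> {8..8 + d}" if f: "f \<in> spider d" "f \<noteq> {}" "Max f \<ge> 8" for f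
    using f(1)
  proof (cases rule: spider_cases)
    case (2 k)
    then have "Max f \<in> {parent k, k}"
      using Max_in[OF f(1,2)] by blast
    then show ?thesis
      using f(3) parent_bounds(3)[OF 2(1)] 2(1) by auto
  qed
  fix f g h
  assume "f \<in> relabel id (spider d)" "g \<in> relabel id (spider d)"
    and fg: "f \<noteq> g \<and> card f = card g \<and> Max f = Max g" and h: "h \<subseteq> f \<union> g \<and> card h = card f"
  then have f: "f \<in> spider d" and g: "g \<in> spider d"
    by (simp_all add: rel)
  then have "finite f" "finite g"
    using abstract_complexD(2)[OF abstract_complex_spider] by blast+
  then have ne: "f \<noteq> {}" "g \<noteq> {}"
    using fg by auto
  show "h \<in> relabel id (spider d)"
  proof (cases "Max f < 8")
    case True
    \<comment> \<open>Size separates the two forms given by \<open>small\<close>, except at the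
      root, where \<open>parent 1 = 1\<close> makes them coincide.\<close>
    have "{Max f} = {parent (Max f), Max f}" if "card {Max f} = card {parent (Max f), Max f}"
      using that by (intro card_subset_eq) auto
    then have "f = g"
      using small[OF f ne(1)] small[OF g ne(2)] fg True by metis
    then show ?thesis
      using fg by simp
  next
    case False
    then have "h \<subseteq> {8..8 + d}"
      using large[OF f ne(1)] large[OF g ne(2)] fg h by auto
    then show ?thesis
      unfolding rel by (simp add: spider_def)
  qed
qed

section \<open>Tree edges and the failure of underclosedness\<close>

lemma spider_edge_iff:
  assumes "x \<in> {1..7}" "y \<in> {1..7}" "x \<noteq> y"
  shows "{x, y} \<in> spider d \<longleftrightarrow> x = parent y \<or> y = parent x"
proof
  assume "{x, y} \<in> spider d"
  then show "x = parent y \<or> y = parent x"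
    using assms by (auto elim!: spider_cases)
next
  have edge: "{parent k, k} \<in> spider d" if "k \<in> {1..7}" "k \<noteq> parent k" for k
  proof -
    \<comment> \<open>The formula gives \<open>parent 1 = 1\<close>, so
      \<open>k \<noteq> parent k\<close> excludes exactly the root.\<close>
    have "k \<noteq> 1"
      using that(2) by (auto simp: parent_def)
    then have "k \<in> {2..7}"
      using that(1) by auto
    then show ?thesis
      by (auto simp: spider_def)
  qed
  assume "x = parent y \<or> y = parent x"
  then show "{x, y} \<in> spider d"
    using edge[of x] edge[of y] assms by (auto simp: insert_commute)
qed

text \<open>Comparing larger ends shows that no tree edge contains another. Underclosedness
  constrains only facets, so this is what makes it apply to tree edges.\<close>

lemma spider_edge_facet:
  assumes "k \<in> {2..7}"
  shows "{parent k, k} \<in> facets (spider d)"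
proof -
  have "G = {parent k, k}" if G: "G \<in> spider d" "{parent k, k} \<subseteq> G" for G
    using G(1)
  proof (cases rule: spider_cases)
    case 1
    then show ?thesis
      using G(2) assms by auto
  next
    case (2 j)
    then have "{parent k, k} \<subseteq> {parent j, j}"
      using G(2) by blast
    then have "k = j"
      using parent_bounds(2)[OF assms] parent_bounds(2)[OF 2(1)] by auto
    then show ?thesis
      using G(2) 2(2) by blast
  qed
  then show ?thesis
    using assms by (auto simp: facets_def spider_def)
qed

text \<open>At most one child of the root can be labeled below the root and at most one above it,
  but there are three children. Only the relative order of the seven tree labels matters.\<close>

lemma not_underclosed_spider: "\<not> underclosed (spider d)"
proof
  assume "underclosed (spider d)"
  then obtain l :: "nat \<Rightarrow> nat" where inj: "inj_on l (vertices (spider d))"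
    and edge: "\<And>x y z. {x, y} \<in> facets (spider d) \<Longrightarrow> z \<in> vertices (spider d) \<Longrightarrow> l x < l z \<Longrightarrow>
      l z \<le> l y \<Longrightarrow> {x, z} \<in> spider d"
    using underclosed_edge by metis
  \<comment> \<open>Underclosedness at the edge \<open>{x, y}\<close> would make \<open>x\<close>
    and \<open>z\<close> adjacent, which the last two assumptions exclude.\<close>
  have no: "\<not> (l x < l z \<and> l z \<le> l y)"
    if xyz: "x \<in> {1..7}" "y \<in> {1..7}" "z \<in> {1..7}" "x \<noteq> y" "x = parent y \<or> y = parent x"
      "x \<noteq> parent z" "z \<noteq> parent x" for x y z
  proof
    assume le: "l x < l z \<and> l z \<le> l y"
    have "{x, y} \<in> facets (spider d)"
    proof (cases "x = parent y")
      case True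
      then have "y \<in> {2..7}"
        using xyz(2,4) by (cases "y = 1") (auto simp: parent_def)
      then show ?thesis
        using spider_edge_facet True by simp
    next
      case False
      then have "x \<in> {2..7}"
        using xyz(1,4,5) by (cases "x = 1") (auto simp: parent_def)
      then show ?thesis
        using spider_edge_facet[of x d] False xyz(5) by (simp add: insert_commute)
    qed
    moreover have "z \<in> vertices (spider d)"
      using xyz(3) by (simp add: vertices_spider)
    ultimately have "{x, z} \<in> spider d"
      using edge le by blast
    moreover have "x \<noteq> z"
      using le by auto
    ultimately show False
      using spider_edge_iff xyz by blast
  qed
  have neq: "l x \<noteq> l y" if "x \<in> {1..7}" "y \<in> {1..7}" "x \<noteq> y" for x y
    using inj_onD[OF inj, of x y] that by (auto simp: vertices_spider)
  \<comment> \<open>The edge from \<open>i\<close> to the root would force the siblings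
    \<open>i\<close> and \<open>j\<close> to be adjacent.\<close>
  have below: "\<not> (l i < l j \<and> l j < l 1)" if "i \<in> {2..4}" "j \<in> {2..4}" for i j
  proof -
    have "i \<noteq> parent j" "j \<noteq> parent i" "parent i = 1"
      using that by (auto simp: parent_def)
    then show ?thesis
      using no[of i 1 j] that by fastforce
  qed
  have above: "\<not> (l 1 < l i \<and> l i < l j)" if ij: "i \<in> {2..4}" "j \<in> {2..4}" for i j
  proof
    assume le: "l 1 < l i \<and> l i < l j"
    have p: "parent i = 1" "parent j = 1" "parent (i + 3) = i" "parent 1 = 1"
      using ij by (auto simp: parent_def)
    \<comment> \<open>The leaf \<open>i + 3\<close> has no possible place. Between the root and
      \<open>j\<close>, the edge \<open>{1, j}\<close> would join it to the root; below the root,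
      its own edge to \<open>i\<close> would do so; beyond \<open>j\<close>, that edge would join
      \<open>i\<close> to \<open>j\<close>.\<close>
    have "\<not> (l 1 < l (i + 3) \<and> l (i + 3) \<le> l j)"
      using ij p by (intro no) auto
    moreover have "\<not> (l (i + 3) < l 1 \<and> l 1 \<le> l i)"
      using ij p by (intro no) auto
    moreover have "\<not> (l i < l j \<and> l j \<le> l (i + 3))"
      using ij p by (intro no) auto
    moreover have "l (i + 3) \<noteq> l 1"
      using ij by (intro neq) auto
    ultimately show False
      using le by linarith
  qed
  have one_below: "\<not> (l i < l 1 \<and> l j < l 1)" if "i \<in> {2..4}" "j \<in> {2..4}" "i \<noteq> j" for i j
  proof -
    have "l i < l j \<or> l j < l i"
      using neq[of i j] that by fastforce
    then show ?thesis
      using below[of i j] below[of j i] that by blast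
  qed
  have one_above: "\<not> (l 1 < l i \<and> l 1 < l j)" if "i \<in> {2..4}" "j \<in> {2..4}" "i \<noteq> j" for i j
  proof -
    have "l i < l j \<or> l j < l i"
      using neq[of i j] that by fastforce
    then show ?thesis
      using above[of i j] above[of j i] that by blast
  qed
  \<comment> \<open>Pigeonhole: three children, two sides of the root.\<close>
  have "l i < l 1 \<or> l 1 < l i" if "i \<in> {2..4}" for i
    using neq[of i 1] that by fastforce
  from this[of 2] this[of 3] this[of 4] show False
    using one_below[of 2 3] one_below[of 2 4] one_below[of 3 4]
      one_above[of 2 3] one_above[of 2 4] one_above[of 3 4]
    by auto
qed

theorem theorem40:
  fixes d :: nat
  assumes "d \<ge> 1"
  shows
    "(\<forall>\<Delta> :: 'a set set. abstract_complex \<Delta> \<and> complex_dim \<Delta> = int d \<and> unit_interval \<Delta>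
        \<longrightarrow> skeleton_E_chordal \<Delta>) \<and>
     (\<forall>\<Delta> :: 'a set set. abstract_complex \<Delta> \<and> complex_dim \<Delta> = int d \<and> underclosed \<Delta>
        \<longrightarrow> skeleton_weakly_chordal \<Delta>) \<and>
     (\<exists>\<Delta> :: nat set set. abstract_complex \<Delta> \<and> complex_dim \<Delta> = int d \<and>
        skeleton_E_chordal \<Delta> \<and> \<not> unit_interval \<Delta>) \<and>
     (\<exists>\<Delta> :: nat set set. abstract_complex \<Delta> \<and> complex_dim \<Delta> = int d \<and>
        skeleton_weakly_chordal \<Delta> \<and> \<not> underclosed \<Delta>)"
proof (intro conjI)
  note spider = abstract_complex_spider[of d] complex_dim_spider[OF assms]
    skeleton_E_chordal_spider[of d] not_underclosed_spider[of d]
  show "\<exists>\<Delta> :: nat set set. abstract_complex \<Delta> \<and> complex_dim \<Delta> = int d \<and>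
      skeleton_E_chordal \<Delta> \<and> \<not> unit_interval \<Delta>"
    using spider unit_interval_imp_underclosed by blast
  show "\<exists>\<Delta> :: nat set set. abstract_complex \<Delta> \<and> complex_dim \<Delta> = int d \<and>
      skeleton_weakly_chordal \<Delta> \<and> \<not> underclosed \<Delta>"
    using spider skeleton_E_chordal_imp_skeleton_weakly_chordal by blast
qed (simp_all add: unit_interval_imp_skeleton_E_chordal underclosed_imp_skeleton_weakly_chordal)

end
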